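(* For each weight vector $\mathbf{w}=(w_1,\dots,w_n)$, the non-crossing variables of degree $\mathbf{w}$ (i.e. the $X_\Gamma$ with $\Gamma$ a non-crossing graph of multidegree $\mathbf{w}$, one orientation being chosen for each underlying undirected graph) form a basis, over $\mathbb{Z}$, of the abelian group $\langle X_\Gamma\rangle_{\mathbf{deg}\,\Gamma=\mathbf{w}}$ generated by all $X_\Gamma$ with $\mathbf{deg}\,\Gamma=\mathbf{w}$.
   Context: A weight vector is an $n$-tuple of positive integers. A graph is a directed graph on $n$ vertices labeled $1,\dots,n$; multiple edges are allowed, loops are not. The multidegree $\mathbf{deg}\,\Gamma$ is the $n$-tuple of valences of the vertices. For an edge $e$, $h(e)$ and $t(e)$ denote its head and tail. Define $$X_\Gamma=\prod_{e\in\Gamma}\bigl(u_{h(e)}v_{t(e)}-u_{t(e)}v_{h(e)}\bigr)\in\mathbb{Z}[u_1,v_1,\dots,u_n,v_n],$$ a section of $\mathcal{O}(\mathbf{deg}\,\Gamma)$ on $(\mathbb{P}^1)^n$, where $[u_i;v_i]$ are the homogeneous coordinates on the $i$th factor. Reversing an edge of $\Gamma$ changes $X_\Gamma$ by a sign, so up to sign $X_\Gamma$ depends only on the underlying undirected multigraph. Place the vertices $1,\dots,n$ clockwise in order as the vertices of a regular $n$-gon, with edges drawn as straight segments. A graph is non-crossing if no two of its edges cross; two edges sharing one or two vertices are considered not to cross. The variable $X_\Gamma$ is called non-crossing if $\Gamma$ is. *)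

theory Defs
  imports
    "HOL-Analysis.Analysis"
    "HOL-Library.Poly_Mapping"
    "HOL-Library.Multiset"
    "HOL-Computational_Algebra.Group_Closure"
begin

(* Integer polynomials in the variables u_i, v_i as the monoid algebra provided by Poly_Mapping:
   finitely supported integer combinations of finitely supported exponent vectors.
   All natural numbers occur as indices; for graphs on {1..n} only the indices 1, ..., n are
   used. *)

datatype coord = Ucoord nat | Vcoord nat

type_synonym int_mpoly = "(coord \<Rightarrow>\<^sub>0 nat) \<Rightarrow>\<^sub>0 int"

definition mvar :: "coord \<Rightarrow> int_mpoly" where
  "mvar x = Poly_Mapping.single (Poly_Mapping.single x 1) 1"

abbreviation uvar :: "nat \<Rightarrow> int_mpoly" where "uvar i \<equiv> mvar (Ucoord i)"
abbreviation vvar :: "nat \<Rightarrow> int_mpoly" where "vvar i \<equiv> mvar (Vcoord i)"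

definition zscale :: "int \<Rightarrow> int_mpoly \<Rightarrow> int_mpoly" where
  "zscale k p = of_int k * p"

global_interpretation zmod: module zscale
  by standard (simp_all add: zscale_def algebra_simps)

(* An edge is the pair (tail, head); a directed multigraph is the multiset of its edges, the
   vertex set {1..n} being given by the number n. *)

type_synonym edge = "nat \<times> nat"
type_synonym digraph = "edge multiset"

abbreviation tail :: "edge \<Rightarrow> nat" where "tail e \<equiv> fst e"
abbreviation head :: "edge \<Rightarrow> nat" where "head e \<equiv> snd e"

definition ends :: "edge \<Rightarrow> nat set" where
  "ends e = {tail e, head e}"

definition is_graph :: "nat \<Rightarrow> digraph \<Rightarrow> bool" where
  "is_graph n G \<longleftrightarrow> (\<forall>e\<in>#G. ends e \<subseteq> {1..n} \<and> tail e \<noteq> head e)"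

definition underlying :: "digraph \<Rightarrow> nat set multiset" where
  "underlying G = image_mset ends G"

definition valence :: "digraph \<Rightarrow> nat \<Rightarrow> nat" where
  "valence G i = size {#e \<in># G. i \<in> ends e#}"

definition graphs_of_degree :: "nat \<Rightarrow> (nat \<Rightarrow> nat) \<Rightarrow> digraph set" where
  "graphs_of_degree n w = {G. is_graph n G \<and> (\<forall>i\<in>{1..n}. valence G i = w i)}"

definition Xvar :: "digraph \<Rightarrow> int_mpoly" where
  "Xvar G = (\<Prod>e\<in>#G. uvar (head e) * vvar (tail e) - uvar (tail e) * vvar (head e))"

(* The regular n-gon is inscribed in the unit circle; the minus sign makes the labelling
   clockwise. *)

definition vertex_pos :: "nat \<Rightarrow> nat \<Rightarrow> complex" where
  "vertex_pos n i = cis (- (2 * pi * real i / real n))"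

definition edge_segment :: "nat \<Rightarrow> edge \<Rightarrow> complex set" where
  "edge_segment n e = closed_segment (vertex_pos n (tail e)) (vertex_pos n (head e))"

definition crosses :: "nat \<Rightarrow> edge \<Rightarrow> edge \<Rightarrow> bool" where
  "crosses n e f \<longleftrightarrow> ends e \<inter> ends f = {} \<and> edge_segment n e \<inter> edge_segment n f \<noteq> {}"

definition noncrossing :: "nat \<Rightarrow> digraph \<Rightarrow> bool" where
  "noncrossing n G \<longleftrightarrow> (\<forall>e\<in>#G. \<forall>f\<in>#G. \<not> crosses n e f)"

definition noncrossing_graphs_of_degree :: "nat \<Rightarrow> (nat \<Rightarrow> nat) \<Rightarrow> digraph set" where
  "noncrossing_graphs_of_degree n w = {G \<in> graphs_of_degree n w. noncrossing n G}"

(* R picks exactly one orientation of each undirected graph underlying a member of S. *)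

definition orientation_choice :: "digraph set \<Rightarrow> digraph set \<Rightarrow> bool" where
  "orientation_choice S R \<longleftrightarrow> R \<subseteq> S \<and> bij_betw underlying R (underlying ` S)"

(* The family of f i for i in I is a Z-basis of A; injectivity on I makes this a statement about
   the family and not merely about the set of its values. *)

definition is_int_basis :: "('i \<Rightarrow> int_mpoly) \<Rightarrow> 'i set \<Rightarrow> int_mpoly set \<Rightarrow> bool" where
  "is_int_basis f I A \<longleftrightarrow>
     inj_on f I \<and> zmod.independent (f ` I) \<and> zmod.span (f ` I) = A"

end

theory Submission
  imports Defs
begin

text \<open>
  Spanning: the Pluecker relation [ac][bd] = [ab][cd] + [ad][bc] replaces a crossing pair of edges
  by non-crossing pairs, and it lowers the sum over all edges of l (n - l), where l is the
  difference of the labels of the two ends; so the straightening terminates.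

  Independence: the leading monomial of an X-variable is the product of u_i v_j over the edges
  joining i < j. It records how many edges go to the right and to the left at each vertex, and this
  determines a non-crossing graph, just as opening and closing brackets determine their matching.
\<close>

section \<open>Chords of the regular polygon\<close>

text \<open>Twice the signed area of the triangle \<open>p q r\<close>: positive when the corners
  run counterclockwise, negative when clockwise, zero when collinear.\<close>

definition orient :: "complex \<Rightarrow> complex \<Rightarrow> complex \<Rightarrow> real" where
  "orient p q r = (Re q - Re p) * (Im r - Im p) - (Im q - Im p) * (Re r - Re p)"

lemma sin_double_triple:
  fixes x y :: real
  shows "sin (2 * x) + sin (2 * y) - sin (2 * (x + y)) = 4 * sin x * sin y * sin (x + y)"
proof -
  have "sin (2 * (x + y)) = sin (2 * x) * cos (2 * y) + cos (2 * x) * sin (2 * y)"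
    by (simp add: distrib_left sin_add)
  then have "sin (2 * x) + sin (2 * y) - sin (2 * (x + y))
      = sin (2 * x) * (1 - cos (2 * y)) + sin (2 * y) * (1 - cos (2 * x))"
    by (simp add: algebra_simps)
  also have "\<dots> = 4 * sin x * sin y * sin (x + y)"
    unfolding cos_double_sin sin_double sin_add by (simp add: power2_eq_square algebra_simps)
  finally show ?thesis .
qed

text \<open>The area of an inscribed triangle is the signed sum of three triangles at the centre,
  each contributing the sine of a difference of angles. \<open>sin_double_triple\<close>, applied to
  half the angles, factors this sum, so the sign can be read off.\<close>

lemma orient_cis:
  "orient (cis a) (cis b) (cis c) = 4 * sin ((b - a) / 2) * sin ((c - b) / 2) * sin ((c - a) / 2)"
proof -
  have "orient (cis a) (cis b) (cis c) = sin (b - a) + sin (c - b) - sin (c - a)"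
    by (simp add: orient_def sin_diff algebra_simps)
  moreover have "2 * ((b - a) / 2) = b - a" "2 * ((c - b) / 2) = c - b"
    "2 * ((c - a) / 2) = c - a" "(b - a) / 2 + (c - b) / 2 = (c - a) / 2"
    by (simp_all add: field_simps)
  ultimately show ?thesis
    using sin_double_triple[of "(b - a) / 2" "(c - b) / 2"] by (simp only:)
qed

text \<open>The minus sign in \<open>vertex_pos\<close> puts each of the three half-angles strictly
  between - pi and 0. All three sines are negative, hence so is their product.\<close>

lemma orient_vertex_pos:
  assumes "1 \<le> i" "i < j" "j < k" "k \<le> n"
  shows "orient (vertex_pos n i) (vertex_pos n j) (vertex_pos n k) < 0"
proof -
  have *: "sin ((- (2 * pi * real q / real n) - - (2 * pi * real p / real n)) / 2) < 0"
    if "1 \<le> p" "p < q" "q \<le> n" for p q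
  proof -
    have eq: "(- (2 * pi * real q / real n) - - (2 * pi * real p / real n)) / 2
        = - (pi * ((real q - real p) / real n))"
      using that by (simp add: field_simps)
    have "0 < (real q - real p) / real n" "(real q - real p) / real n < 1"
      using that by simp_all
    then have "0 < sin (pi * ((real q - real p) / real n))"
      using mult_strict_left_mono[of "(real q - real p) / real n" 1 pi]
      by (intro sin_gt_zero mult_pos_pos) (simp_all only: pi_gt_zero mult_1_right)
    then show ?thesis
      by (simp only: eq sin_minus neg_less_0_iff_less)
  qed
  have "orient (vertex_pos n i) (vertex_pos n j) (vertex_pos n k) =
     4 * (sin ((- (2 * pi * real j / real n) - - (2 * pi * real i / real n)) / 2)
     * sin ((- (2 * pi * real k / real n) - - (2 * pi * real j / real n)) / 2))
     * sin ((- (2 * pi * real k / real n) - - (2 * pi * real i / real n)) / 2)"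
    unfolding vertex_pos_def orient_cis by (simp only: mult.assoc)
  also have "\<dots> < 0"
    using *[of i j] *[of j k] *[of i k] assms
    by (intro mult_pos_neg mult_pos_pos mult_neg_neg) simp_all
  finally show ?thesis .
qed

lemma orient_swap:
  "orient q p r = - orient p q r" "orient p r q = - orient p q r"
  by (simp_all add: orient_def algebra_simps)

text \<open>The function \<open>orient p q\<close> vanishes on the line through \<open>p\<close> and
  \<open>q\<close> and is affine along the other segment, where it keeps the common nonzero sign it
  has at \<open>r\<close> and \<open>s\<close>.\<close>

lemma closed_segments_disjoint:
  assumes "0 < orient p q r * orient p q s"
  shows "closed_segment p q \<inter> closed_segment r s = {}"
proof -
  have on_line: "orient p q z = 0" if z: "z \<in> closed_segment p q" for z
  proof -
    obtain u where zu: "z = (1 - u) *\<^sub>R p + u *\<^sub>R q"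
      using z by (auto simp: in_segment)
    show ?thesis unfolding zu by (simp add: orient_def algebra_simps)
  qed
  have off_line: "orient p q z \<noteq> 0" if z: "z \<in> closed_segment r s" for z
  proof -
    obtain u where u: "0 \<le> u" "u \<le> 1" and zu: "z = (1 - u) *\<^sub>R r + u *\<^sub>R s"
      using z by (auto simp: in_segment)
    have "orient p q z = (1 - u) * orient p q r + u * orient p q s"
      unfolding zu by (simp add: orient_def algebra_simps)
    moreover have "\<dots> \<noteq> 0"
    proof (cases "0 < orient p q r")
      case True
      then have "0 < orient p q s" using assms by (simp add: zero_less_mult_iff)
      then show ?thesis
        \<comment> \<open>The sign is flipped so that the upper bound for convex combinations covers
          the positive case too.\<close>
        using True u convex_bound_lt[of "- orient p q r" 0 "- orient p q s" "1 - u" u] by auto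
    next
      case False
      then have "orient p q r < 0" "orient p q s < 0"
        using assms by (auto simp: zero_less_mult_iff)
      then show ?thesis
        using u convex_bound_lt[of "orient p q r" 0 "orient p q s" "1 - u" u] by auto
    qed
    ultimately show ?thesis by simp
  qed
  show ?thesis using on_line off_line by blast
qed

text \<open>The four points form a convex quadrilateral traversed clockwise. The meeting point of
  its diagonals has ratios of triangle areas as coordinates; \<open>S\<close> is twice the signed
  area of the whole, cut along either diagonal.\<close>

lemma closed_segments_meet:
  assumes "orient p q r < 0" "orient q r s < 0" "orient p q s < 0" "orient p r s < 0"
  shows "closed_segment p r \<inter> closed_segment q s \<noteq> {}"
proof -
  define S where "S = orient q r s + orient p q s"
  have S: "S = orient p r s + orient p q r"
    by (simp add: S_def orient_def algebra_simps)
  have "S < 0" using assms by (simp add: S_def)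
  define z where "z = (1 - orient p q s / S) *\<^sub>R p + (orient p q s / S) *\<^sub>R r"
  have z': "z = (1 - orient p q r / S) *\<^sub>R q + (orient p q r / S) *\<^sub>R s"
  proof -
    have 1: "1 - orient p q s / S = orient q r s / S"
      using \<open>S < 0\<close> by (simp add: S_def field_simps)
    have 2: "1 - orient p q r / S = orient p r s / S"
      using \<open>S < 0\<close> by (simp add: S field_simps)
    \<comment> \<open>This is the affine dependence among four points of the plane, with signed
      areas as coefficients. Divided by \<open>S\<close>, it equates the two descriptions of
      \<open>z\<close>.\<close>
    have "orient q r s *\<^sub>R p + orient p q s *\<^sub>R r = orient p r s *\<^sub>R q + orient p q r *\<^sub>R s"
      by (simp add: complex_eq_iff orient_def algebra_simps)
    then have "inverse S *\<^sub>R (orient q r s *\<^sub>R p + orient p q s *\<^sub>R r)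
        = inverse S *\<^sub>R (orient p r s *\<^sub>R q + orient p q r *\<^sub>R s)"
      by (rule arg_cong)
    then show ?thesis
      unfolding z_def 1 2 by (simp add: scaleR_add_right field_simps)
  qed
  have "z \<in> closed_segment p r"
    unfolding in_segment z_def using assms \<open>S < 0\<close>
    by (intro exI[of _ "orient p q s / S"]) (auto simp: S_def field_simps)
  moreover have "z \<in> closed_segment q s"
    unfolding in_segment z' using assms \<open>S < 0\<close>
    by (intro exI[of _ "orient p q r / S"]) (auto simp: S field_simps)
  ultimately show ?thesis by blast
qed

section \<open>Crossing edges and interlacing labels\<close>

lemma edge_segment_ends: "ends e = {i, j} \<Longrightarrow> edge_segment n e = closed_segment (vertex_pos n i) (vertex_pos n j)"
  by (auto simp: ends_def edge_segment_def doubleton_eq_iff closed_segment_commute)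

lemma interlaced_crosses:
  assumes "ends e = {a, c}" "ends f = {b, d}" "1 \<le> a" "a < b" "b < c" "c < d" "d \<le> n"
  shows "crosses n e f"
  using assms closed_segments_meet[OF orient_vertex_pos[of a b c n] orient_vertex_pos[of b c d n]
      orient_vertex_pos[of a b d n] orient_vertex_pos[of a c d n]]
  by (auto simp: crosses_def edge_segment_ends)

lemma ends_sorted:
  assumes "tail e \<noteq> head e"
  obtains i j where "i < j" "ends e = {i, j}"
  using assms by (metis ends_def insert_commute linorder_neqE_nat)

text \<open>The line through a chord separates the vertices labelled strictly between its ends from
  all remaining ones. A chord that meets it without sharing an end must have one end on each
  side.\<close>

lemma crosses_interlaced:
  assumes "crosses n e f" "tail e \<noteq> head e" "tail f \<noteq> head f" "ends e \<subseteq> {1..n}" "ends f \<subseteq> {1..n}"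
  obtains a b c d where "1 \<le> a" "a < b" "b < c" "c < d" "d \<le> n"
    "ends e = {a, c} \<and> ends f = {b, d} \<or> ends e = {b, d} \<and> ends f = {a, c}"
proof -
  obtain p q where pq: "p < q" "ends e = {p, q}" using assms(2) by (rule ends_sorted)
  obtain r s where rs: "r < s" "ends f = {r, s}" using assms(3) by (rule ends_sorted)
  have bounds: "1 \<le> p" "q \<le> n" "1 \<le> r" "s \<le> n"
    using assms(4,5) pq rs by auto
  have distinct: "p \<noteq> r" "p \<noteq> s" "q \<noteq> r" "q \<noteq> s"
    using assms(1) pq rs by (auto simp: crosses_def)
  \<comment> \<open>The sign of \<open>?o i\<close> tells on which side of the line through the
    vertices \<open>p\<close> and \<open>q\<close> the vertex \<open>i\<close> lies.\<close>
  let ?o = "\<lambda>i. orient (vertex_pos n p) (vertex_pos n q) (vertex_pos n i)"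
  have inside: "0 < ?o i" if "p < i" "i < q" for i
    using orient_vertex_pos[of p i q n] that bounds
      orient_swap(2)[of "vertex_pos n p" "vertex_pos n q" "vertex_pos n i"] by simp
  have outside: "?o i < 0" if "1 \<le> i" "i \<le> n" "i < p \<or> q < i" for i
    using orient_vertex_pos[of i p q n] orient_vertex_pos[of p q i n] that bounds pq
      orient_swap(1)[of "vertex_pos n p" "vertex_pos n i" "vertex_pos n q"]
      orient_swap(2)[of "vertex_pos n p" "vertex_pos n i" "vertex_pos n q"]
    by auto
  have "\<not> 0 < ?o r * ?o s"
    using closed_segments_disjoint[of "vertex_pos n p" "vertex_pos n q" "vertex_pos n r" "vertex_pos n s"] assms(1) pq rs
    by (auto simp: crosses_def edge_segment_ends)
  then have "\<not> (0 < ?o r \<and> 0 < ?o s)" "\<not> (?o r < 0 \<and> ?o s < 0)"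
    by (auto simp: zero_less_mult_iff)
  moreover have "r \<le> n" "1 \<le> s" using bounds rs by simp_all
  ultimately have "\<not> (p < r \<and> r < q \<and> p < s \<and> s < q)" "\<not> ((r < p \<or> q < r) \<and> (s < p \<or> q < s))"
    using inside[of r] inside[of s] outside[of r] outside[of s] bounds by blast+
  then have "p < r \<and> r < q \<and> q < s \<or> r < p \<and> p < s \<and> s < q"
    using distinct pq rs by linarith
  then show ?thesis
    using that[of p r q s] that[of r p s q] bounds pq rs by blast
qed

section \<open>Graphs up to orientation\<close>

definition sort_edge :: "edge \<Rightarrow> edge" where
  "sort_edge e = (min (tail e) (head e), max (tail e) (head e))"

text \<open>A canonical orientation, from smaller to larger label, so that undirected graphs can be
  compared as multisets of ordered pairs and the two ends be counted separately.\<close>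

definition arcs :: "digraph \<Rightarrow> edge multiset" where
  "arcs G = image_mset sort_edge G"

lemma sort_edge_ends: "sort_edge e = (Min (ends e), Max (ends e))"
  by (simp add: sort_edge_def ends_def)

lemma ends_sort_edge [simp]: "ends (sort_edge e) = ends e"
  by (auto simp: sort_edge_def ends_def min_def max_def)

text \<open>The sorted pair is recovered from the set of ends by \<open>Min\<close> and
  \<open>Max\<close>, and the set of ends from the sorted pair by \<open>ends\<close>.\<close>

lemma arcs_eq_iff: "arcs G = arcs H \<longleftrightarrow> underlying G = underlying H"
proof
  assume "underlying G = underlying H"
  then have "image_mset (\<lambda>A. (Min A, Max A)) (underlying G) = image_mset (\<lambda>A. (Min A, Max A)) (underlying H)"
    by simp
  then show "arcs G = arcs H"
    by (simp add: arcs_def underlying_def multiset.map_comp comp_def sort_edge_ends[abs_def])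
next
  assume "arcs G = arcs H"
  then have "image_mset ends (arcs G) = image_mset ends (arcs H)" by simp
  then show "underlying G = underlying H"
    by (simp add: arcs_def underlying_def multiset.map_comp comp_def)
qed

lemma valence_add_mset: "valence (add_mset e G) i = (if i \<in> ends e then 1 else 0) + valence G i"
  by (simp add: valence_def)

lemma arcs_lessD: "is_graph n G \<Longrightarrow> x \<in># arcs G \<Longrightarrow> 1 \<le> fst x \<and> fst x < snd x \<and> snd x \<le> n"
  by (auto simp: is_graph_def arcs_def sort_edge_def ends_def min_def max_def)

text \<open>Matching brackets: the innermost arc with the leftmost right end is determined by the
  two multisets of ends, and it may be removed.\<close>

lemma noncrossing_arcs_unique:
  fixes M N :: "('a::linorder \<times> 'a) multiset"
  assumes "\<And>x. x \<in># M \<Longrightarrow> fst x < snd x" "\<And>x. x \<in># N \<Longrightarrow> fst x < snd x"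
    and "\<And>a b c d. (a, c) \<in># M \<Longrightarrow> (b, d) \<in># M \<Longrightarrow> \<not> (a < b \<and> b < c \<and> c < d)"
    and "\<And>a b c d. (a, c) \<in># N \<Longrightarrow> (b, d) \<in># N \<Longrightarrow> \<not> (a < b \<and> b < c \<and> c < d)"
    and "image_mset fst M = image_mset fst N" "image_mset snd M = image_mset snd N"
  shows "M = N"
  using assms
proof (induction "size M" arbitrary: M N)
  case 0
  then show ?case by simp
next
  case (Suc k)
  define r where "r = Min (snd ` set_mset M)"
  define l where "l = Max {i \<in> fst ` set_mset M. i < r}"
  \<comment> \<open>The claim is made for any \<open>P\<close> with the same ends as
    \<open>M\<close>, because it is needed for both \<open>M\<close> and \<open>N\<close>.\<close>
  have innermost: "(l, r) \<in># P"
    if eq: "image_mset fst P = image_mset fst M" "image_mset snd P = image_mset snd M"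
      and less: "\<And>x. x \<in># P \<Longrightarrow> fst x < snd x"
      and nc: "\<And>a b c d. (a, c) \<in># P \<Longrightarrow> (b, d) \<in># P \<Longrightarrow> \<not> (a < b \<and> b < c \<and> c < d)" for P
  proof -
    have fsts: "fst ` set_mset P = fst ` set_mset M" and snds: "snd ` set_mset P = snd ` set_mset M"
      using eq by (metis set_image_mset)+
    have "M \<noteq> {#}" using Suc.hyps(2) by auto
    then have "r \<in> snd ` set_mset P" unfolding snds r_def by (intro Min_in) auto
    then obtain a where a: "(a, r) \<in># P" by auto
    then have "a \<in> {i \<in> fst ` set_mset M. i < r}"
      using less fsts by force
    then have "a \<le> l" and l: "l \<in> {i \<in> fst ` set_mset M. i < r}"
      unfolding l_def by (intro Max_ge Max_in; force)+
    from l obtain d where d: "(l, d) \<in># P" using fsts by force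
    then have "r \<le> d" using snds unfolding r_def by (intro Min_le) force+
    \<comment> \<open>If \<open>a < l\<close> and \<open>r < d\<close>, the arcs
      \<open>(a, r)\<close> and \<open>(l, d)\<close> would cross. Hence \<open>a = l\<close> or
      \<open>d = r\<close>, and one of the two arcs is \<open>(l, r)\<close>.\<close>
    show ?thesis
      using nc[OF a d] \<open>a \<le> l\<close> \<open>r \<le> d\<close> l a d by (cases "a = l"; cases "d = r") auto
  qed
  have M: "(l, r) \<in># M" and N: "(l, r) \<in># N"
    using Suc.prems by (auto intro!: innermost)
  have "M - {#(l, r)#} = N - {#(l, r)#}"
  proof (rule Suc.hyps(1))
    show "k = size (M - {#(l, r)#})"
      using Suc.hyps(2) M by (simp add: size_Diff_singleton)
  qed (use Suc.prems M N in \<open>auto dest!: in_diffD simp: image_mset_Diff\<close>)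
  then show ?case using M N by (metis insert_DiffM)
qed

section \<open>Leading monomials\<close>

text \<open>The variable u_i has the weight n - i and every v_i the weight 0, which makes u_i v_j
  heavier than u_j v_i for i < j.\<close>

definition u_weight :: "nat \<Rightarrow> (coord \<Rightarrow>\<^sub>0 nat) \<Rightarrow> nat" where
  "u_weight n m = (\<Sum>i\<in>{1..n}. (n - i) * Poly_Mapping.lookup m (Ucoord i))"

text \<open>The weight is not a total order on monomials, but only the top one has to be isolated:
  every other monomial is strictly lighter.\<close>

definition has_leading_monomial :: "nat \<Rightarrow> int_mpoly \<Rightarrow> (coord \<Rightarrow>\<^sub>0 nat) \<Rightarrow> bool" where
  "has_leading_monomial n p m \<longleftrightarrow>
     (\<exists>c r. \<bar>c\<bar> = 1 \<and> p = Poly_Mapping.single m c + r \<and>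
        (\<forall>k\<in>Poly_Mapping.keys r. u_weight n k < u_weight n m))"

definition arc_monomial :: "edge \<Rightarrow> (coord \<Rightarrow>\<^sub>0 nat)" where
  "arc_monomial x = Poly_Mapping.single (Ucoord (fst x)) 1 + Poly_Mapping.single (Vcoord (snd x)) 1"

definition graph_monomial :: "digraph \<Rightarrow> (coord \<Rightarrow>\<^sub>0 nat)" where
  "graph_monomial G = (\<Sum>x\<in>#arcs G. arc_monomial x)"

lemma u_weight_add: "u_weight n (k + m) = u_weight n k + u_weight n m"
  by (simp add: u_weight_def lookup_add distrib_left sum.distrib)

lemma u_weight_arc:
  assumes "1 \<le> i" "i \<le> n"
  shows "u_weight n (arc_monomial (i, j)) = n - i"
proof -
  have "u_weight n (arc_monomial (i, j)) = (\<Sum>k\<in>{1..n}. if k = i then n - i else 0)"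
    unfolding u_weight_def
    by (rule sum.cong) (auto simp: arc_monomial_def lookup_add lookup_single when_def)
  then show ?thesis using assms by simp
qed

text \<open>Weights add, so every product of terms other than the two leading ones loses weight in
  at least one factor and gains it in none. The new coefficient is again a unit of the
  integers.\<close>

lemma has_leading_monomial_mult:
  assumes "has_leading_monomial n p k" "has_leading_monomial n q m"
  shows "has_leading_monomial n (p * q) (k + m)"
proof -
  obtain c r where cr: "\<bar>c\<bar> = 1" "p = Poly_Mapping.single k c + r"
      "\<forall>x\<in>Poly_Mapping.keys r. u_weight n x < u_weight n k"
    using assms(1) unfolding has_leading_monomial_def by blast
  obtain d s where ds: "\<bar>d\<bar> = 1" "q = Poly_Mapping.single m d + s"
      "\<forall>x\<in>Poly_Mapping.keys s. u_weight n x < u_weight n m"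
    using assms(2) unfolding has_leading_monomial_def by blast
  have "p * q = Poly_Mapping.single (k + m) (c * d) + (Poly_Mapping.single k c * s + r * q)"
    by (simp add: cr(2) ds(2) algebra_simps mult_single)
  moreover have "u_weight n x < u_weight n (k + m)"
    if "x \<in> Poly_Mapping.keys (Poly_Mapping.single k c * s + r * q)" for x
  proof -
    have "x \<in> Poly_Mapping.keys (Poly_Mapping.single k c * s) \<or> x \<in> Poly_Mapping.keys (r * q)"
      using that keys_add[of "Poly_Mapping.single k c * s" "r * q"] by blast
    then show ?thesis
    proof
      assume "x \<in> Poly_Mapping.keys (Poly_Mapping.single k c * s)"
      then obtain a b where "x = a + b" "a \<in> Poly_Mapping.keys (Poly_Mapping.single k c)"
          "b \<in> Poly_Mapping.keys s"
        using keys_mult[of "Poly_Mapping.single k c" s] by blast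
      then show ?thesis using ds(3) by (auto simp: u_weight_add split: if_splits)
    next
      assume "x \<in> Poly_Mapping.keys (r * q)"
      then obtain a b where ab: "x = a + b" "a \<in> Poly_Mapping.keys r" "b \<in> Poly_Mapping.keys q"
        using keys_mult[of r q] by blast
      have "b \<in> Poly_Mapping.keys (Poly_Mapping.single m d) \<union> Poly_Mapping.keys s"
        using ab(3) keys_add[of "Poly_Mapping.single m d" s] unfolding ds(2) by blast
      \<comment> \<open>Here \<open>b\<close> may be the leading monomial of \<open>q\<close>; the
        strict loss comes from \<open>a\<close>, which belongs to \<open>r\<close>.\<close>
      then have "u_weight n b \<le> u_weight n m"
        using ds(3) by (auto split: if_splits intro: less_imp_le)
      moreover have "u_weight n a < u_weight n k" using ab(2) cr(3) by blast
      ultimately show ?thesis by (simp add: ab(1) u_weight_add)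
    qed
  qed
  moreover have "\<bar>c * d\<bar> = 1" by (simp add: abs_mult cr(1) ds(1))
  ultimately show ?thesis unfolding has_leading_monomial_def by blast
qed

lemma has_leading_monomial_lookup:
  assumes "has_leading_monomial n p m"
  shows "Poly_Mapping.lookup p m \<noteq> 0"
    and "Poly_Mapping.lookup p k \<noteq> 0 \<Longrightarrow> k = m \<or> u_weight n k < u_weight n m"
proof -
  obtain c r where cr: "\<bar>c\<bar> = 1" "p = Poly_Mapping.single m c + r"
      "\<forall>x\<in>Poly_Mapping.keys r. u_weight n x < u_weight n m"
    using assms unfolding has_leading_monomial_def by blast
  have "m \<notin> Poly_Mapping.keys r" using cr(3) by blast
  then show "Poly_Mapping.lookup p m \<noteq> 0"
    using cr by (auto simp: lookup_add in_keys_iff)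
  show "k = m \<or> u_weight n k < u_weight n m" if "Poly_Mapping.lookup p k \<noteq> 0"
    using that cr(3) by (auto simp: cr(2) lookup_add lookup_single when_def in_keys_iff split: if_splits)
qed

text \<open>Two different candidates would each have to be strictly lighter than the other.\<close>

lemma has_leading_monomial_unique:
  assumes "has_leading_monomial n p k" "has_leading_monomial n p m"
  shows "k = m"
  using has_leading_monomial_lookup[OF assms(1)] has_leading_monomial_lookup[OF assms(2)]
  by (metis less_asym)

section \<open>Independence from distinct leading monomials\<close>

lemma lookup_zscale: "Poly_Mapping.lookup (zscale c p) m = c * Poly_Mapping.lookup p m"
proof -
  have nat_multiple: "Poly_Mapping.lookup (of_nat k * p) m = int k * Poly_Mapping.lookup p m" for k
    by (induction k) (simp_all add: lookup_add algebra_simps)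
  show ?thesis
  proof (cases c)
    case (nonneg k)
    then show ?thesis by (simp add: zscale_def nat_multiple)
  next
    case (neg k)
    then have "zscale c p = - (of_nat (Suc k) * p)"
      by (simp add: zscale_def del: of_nat_Suc)
    then show ?thesis
      using neg by (simp only: nat_multiple lookup_uminus mult_minus_left)
  qed
qed

text \<open>Among the elements with nonzero coefficient in a vanishing combination, take one whose
  leading monomial is heaviest. No other term can cancel that monomial.\<close>

lemma independent_leading_monomials:
  assumes lead: "\<And>p. p \<in> S \<Longrightarrow> has_leading_monomial n p (m p)" and inj: "inj_on m S"
  shows "zmod.independent S"
  unfolding zmod.independent_explicit_module
proof (intro allI impI)
  fix T c v
  assume T: "finite T" "T \<subseteq> S" and sum0: "(\<Sum>p\<in>T. zscale (c p) p) = 0" and "v \<in> T"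
  show "c v = 0"
  proof (rule ccontr)
    assume "c v \<noteq> 0"
    define U where "U = {p \<in> T. c p \<noteq> 0}"
    have "finite U" "v \<in> U"
      using T \<open>v \<in> T\<close> \<open>c v \<noteq> 0\<close> by (auto simp: U_def)
    then obtain p where p: "p \<in> U" and max: "\<And>q. q \<in> U \<Longrightarrow> u_weight n (m q) \<le> u_weight n (m p)"
      using obtains_MAX[of U "\<lambda>p. u_weight n (m p)"] by (metis Max_ge empty_iff finite_imageI imageI)
    have "c q * Poly_Mapping.lookup q (m p) = 0" if "q \<in> T - {p}" for q
    proof (rule ccontr)
      assume *: "c q * Poly_Mapping.lookup q (m p) \<noteq> 0"
      then have q: "q \<in> U" "q \<in> S" using that T by (auto simp: U_def)
      \<comment> \<open>Since \<open>m p\<close> occurs in \<open>q\<close>, it is the leading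
        monomial of \<open>q\<close> or lighter than it; the latter contradicts the choice of
        \<open>p\<close>.\<close>
      have "m p = m q"
        using has_leading_monomial_lookup(2)[OF lead[OF q(2)], of "m p"] * max[OF q(1)] by auto
      then show False using inj q p that T by (auto simp: U_def inj_on_def)
    qed
    then have "(\<Sum>q\<in>T - {p}. c q * Poly_Mapping.lookup q (m p)) = 0"
      by (intro sum.neutral ballI)
    then have "(\<Sum>q\<in>T. c q * Poly_Mapping.lookup q (m p)) = c p * Poly_Mapping.lookup p (m p)"
      using T p by (simp add: U_def sum.remove[of T p])
    moreover have "(\<Sum>q\<in>T. c q * Poly_Mapping.lookup q (m p)) = 0"
      using arg_cong[OF sum0, of "\<lambda>q. Poly_Mapping.lookup q (m p)"] by (simp add: lookup_sum lookup_zscale)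
    ultimately show False
      using has_leading_monomial_lookup(1)[OF lead[of p]] p T by (auto simp: U_def)
  qed
qed

section \<open>Leading monomials of the X-variables\<close>

lemma monomial_mult: "uvar i * vvar j = Poly_Mapping.single (arc_monomial (i, j)) 1"
  by (simp add: mvar_def mult_single arc_monomial_def)

lemma Xvar_add_mset:
  "Xvar (add_mset e G) = (uvar (head e) * vvar (tail e) - uvar (tail e) * vvar (head e)) * Xvar G"
  by (simp add: Xvar_def)

lemma edge_has_leading_monomial:
  assumes "ends e \<subseteq> {1..n}" "tail e \<noteq> head e"
  shows "has_leading_monomial n (uvar (head e) * vvar (tail e) - uvar (tail e) * vvar (head e))
    (arc_monomial (sort_edge e))"
proof -
  have less: "u_weight n (arc_monomial (j, i)) < u_weight n (arc_monomial (i, j))"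
    if "1 \<le> i" "i < j" "j \<le> n" for i j
    using that by (simp add: u_weight_arc diff_less_mono2)
  have "tail e < head e \<or> head e < tail e" using assms(2) by auto
  then show ?thesis
  proof
    assume "tail e < head e"
    then show ?thesis
      unfolding has_leading_monomial_def monomial_mult using less[of "tail e" "head e"] assms(1)
      \<comment> \<open>An edge running from the smaller to the larger label has its heavier term in
        the subtracted product, whence the coefficient - 1.\<close>
      by (intro exI[of _ "- 1"] exI[of _ "Poly_Mapping.single (arc_monomial (head e, tail e)) 1"])
        (auto simp: sort_edge_def ends_def single_uminus)
  next
    assume "head e < tail e"
    then show ?thesis
      unfolding has_leading_monomial_def monomial_mult using less[of "head e" "tail e"] assms(1)
      by (intro exI[of _ 1] exI[of _ "- Poly_Mapping.single (arc_monomial (tail e, head e)) 1"])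
        (auto simp: sort_edge_def ends_def min_def max_def)
  qed
qed

lemma Xvar_has_leading_monomial:
  "is_graph n G \<Longrightarrow> has_leading_monomial n (Xvar G) (graph_monomial G)"
proof (induction G)
  case empty
  have "has_leading_monomial n 1 0"
    unfolding has_leading_monomial_def
    by (intro exI[of _ 1] exI[of _ 0]) simp
  then show ?case by (simp add: Xvar_def graph_monomial_def arcs_def)
next
  case (add e G)
  then have "is_graph n G" "ends e \<subseteq> {1..n}" "tail e \<noteq> head e" by (auto simp: is_graph_def)
  with add.IH have "has_leading_monomial n
      ((uvar (head e) * vvar (tail e) - uvar (tail e) * vvar (head e)) * Xvar G)
      (arc_monomial (sort_edge e) + graph_monomial G)"
    by (intro has_leading_monomial_mult edge_has_leading_monomial)
  then show ?case by (simp add: Xvar_add_mset graph_monomial_def arcs_def)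
qed

text \<open>The exponents count the arcs opening and closing at each vertex, which is exactly the
  data from which \<open>noncrossing_arcs_unique\<close> recovers the arcs.\<close>

lemma lookup_graph_monomial:
  "Poly_Mapping.lookup (graph_monomial G) (Ucoord i) = count (image_mset fst (arcs G)) i"
  "Poly_Mapping.lookup (graph_monomial G) (Vcoord i) = count (image_mset snd (arcs G)) i"
  by (induction G)
    (simp_all add: graph_monomial_def arcs_def arc_monomial_def lookup_add lookup_single when_def)

lemma noncrossing_arcsD:
  assumes "is_graph n G" "noncrossing n G" "(a, c) \<in># arcs G" "(b, d) \<in># arcs G"
  shows "\<not> (a < b \<and> b < c \<and> c < d)"
proof
  assume less: "a < b \<and> b < c \<and> c < d"
  obtain e f where ef: "e \<in># G" "sort_edge e = (a, c)" "f \<in># G" "sort_edge f = (b, d)"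
    using assms(3,4) by (auto simp: arcs_def)
  have "ends e = {a, c}" "ends f = {b, d}"
    using ef ends_sort_edge[of e] ends_sort_edge[of f] by (simp_all add: ends_def)
  then have "crosses n e f"
    using less assms arcs_lessD[OF assms(1)] by (intro interlaced_crosses[of e a c f b d]) force+
  then show False using assms(2) ef by (auto simp: noncrossing_def)
qed

lemma graph_monomial_inj:
  assumes "is_graph n G" "noncrossing n G" "is_graph n H" "noncrossing n H"
    and "graph_monomial G = graph_monomial H"
  shows "underlying G = underlying H"
proof -
  have "image_mset fst (arcs G) = image_mset fst (arcs H)" "image_mset snd (arcs G) = image_mset snd (arcs H)"
    using assms(5) by (simp_all add: multiset_eq_iff flip: lookup_graph_monomial)
  then have "arcs G = arcs H"
    using assms(1-4) by (intro noncrossing_arcs_unique) (auto dest: arcs_lessD noncrossing_arcsD)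
  then show ?thesis by (simp add: arcs_eq_iff)
qed

section \<open>Straightening\<close>

text \<open>The value is symmetric under exchanging l and n - l, so it depends only on how far apart
  the two ends are around the polygon and acts as a substitute for the length of the chord.\<close>

definition edge_potential :: "nat \<Rightarrow> edge \<Rightarrow> nat" where
  "edge_potential n e = (snd (sort_edge e) - fst (sort_edge e)) * (n - (snd (sort_edge e) - fst (sort_edge e)))"

definition potential :: "nat \<Rightarrow> digraph \<Rightarrow> nat" where
  "potential n G = (\<Sum>e\<in>#G. edge_potential n e)"

lemma potential_add_mset: "potential n (add_mset e G) = edge_potential n e + potential n G"
  by (simp add: potential_def)

lemma edge_potential_ends:
  "ends e = {i, j} \<Longrightarrow> i < j \<Longrightarrow> edge_potential n e = (j - i) * (n - (j - i))"
  by (simp add: edge_potential_def sort_edge_ends)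

text \<open>Sorting an edge either keeps it or reverses it, and a reversal negates its
  factor.\<close>

lemma Xvar_arcs: "Xvar G = Xvar (arcs G) \<or> Xvar G = - Xvar (arcs G)"
proof (induction G)
  case empty
  then show ?case by (simp add: arcs_def)
next
  case (add e G)
  have "arcs (add_mset e G) = add_mset (sort_edge e) (arcs G)" by (simp add: arcs_def)
  with add show ?case
    by (cases "tail e \<le> head e") (auto simp: Xvar_add_mset sort_edge_def algebra_simps)
qed

lemma Xvar_underlying:
  assumes "underlying G = underlying H"
  shows "Xvar G = Xvar H \<or> Xvar G = - Xvar H"
  using Xvar_arcs[of G] Xvar_arcs[of H] assms by (auto simp flip: arcs_eq_iff)

text \<open>The diagonals of a quadrilateral outweigh either pair of opposite sides. The first gap
  is 2 (c - b) (n - d + a), the second 2 (b - a) (d - c).\<close>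

lemma potential_resolve:
  fixes a b c d n :: nat
  assumes "1 \<le> a" "a < b" "b < c" "c < d" "d \<le> n"
  shows "(b - a) * (n - (b - a)) + (d - c) * (n - (d - c)) < (c - a) * (n - (c - a)) + (d - b) * (n - (d - b))"
    and "(d - a) * (n - (d - a)) + (c - b) * (n - (c - b)) < (c - a) * (n - (c - a)) + (d - b) * (n - (d - b))"
proof -
  obtain x y z t where xyz: "b = a + Suc x" "c = b + Suc y" "d = c + Suc z" "n = d + t"
    using assms by (metis less_iff_Suc_add le_iff_add add_Suc_right)
  have diffs: "b - a = Suc x" "d - c = Suc z" "c - b = Suc y" "c - a = x + y + 2" "d - b = y + z + 2"
      "d - a = x + y + z + 3" "n - Suc x = a + t + y + z + 2" "n - Suc z = a + t + x + y + 2"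
      "n - Suc y = a + t + x + z + 2" "n - (x + y + 2) = a + t + z + 1" "n - (y + z + 2) = a + t + x + 1"
      "n - (x + y + z + 3) = a + t"
    using xyz by simp_all
  show "(b - a) * (n - (b - a)) + (d - c) * (n - (d - c)) < (c - a) * (n - (c - a)) + (d - b) * (n - (d - b))"
    "(d - a) * (n - (d - a)) + (c - b) * (n - (c - b)) < (c - a) * (n - (c - a)) + (d - b) * (n - (d - b))"
    \<comment> \<open>The outer gap is \<open>a + t\<close> with \<open>t\<close> possibly zero; its
      positivity comes from \<open>1 \<le> a\<close>.\<close>
    using assms(1) unfolding diffs by (simp_all add: algebra_simps)
qed

lemma Xvar_resolve_crossing:
  assumes G: "G \<in> graphs_of_degree n w" and "\<not> noncrossing n G"
  obtains H K where "H \<in> graphs_of_degree n w" "K \<in> graphs_of_degree n w"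
    "potential n H < potential n G" "potential n K < potential n G"
    "Xvar G = Xvar H + Xvar K \<or> Xvar G = - (Xvar H + Xvar K)"
proof -
  obtain e f where ef: "e \<in># G" "f \<in># G" "crosses n e f"
    using assms(2) by (auto simp: noncrossing_def)
  have graph: "is_graph n G" and deg: "\<And>i. i \<in> {1..n} \<Longrightarrow> valence G i = w i"
    using G by (auto simp: graphs_of_degree_def)
  have "ends g \<subseteq> {1..n}" "tail g \<noteq> head g" if "g \<in># G" for g
    using graph that by (auto simp: is_graph_def)
  from crosses_interlaced[OF ef(3) this(2)[OF ef(1)] this(2)[OF ef(2)] this(1)[OF ef(1)] this(1)[OF ef(2)]]
  obtain a b c d where abcd: "1 \<le> a" "a < b" "b < c" "c < d" "d \<le> n"
    and or: "ends e = {a, c} \<and> ends f = {b, d} \<or> ends e = {b, d} \<and> ends f = {a, c}" .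
  obtain g h where gh: "g \<in># G" "h \<in># G" "ends g = {a, c}" "ends h = {b, d}"
    using or ef by blast
  have "g \<noteq> h" using gh abcd by (auto simp: doubleton_eq_iff)
  then obtain G' where G': "G = add_mset g (add_mset h G')"
    using gh by (metis insert_noteq_member mset_add)
  \<comment> \<open>The new edges are directed from smaller to larger label, so that both terms of
    the Pluecker relation carry a plus sign.\<close>
  define H where "H = add_mset (a, b) (add_mset (c, d) G')"
  define K where "K = add_mset (a, d) (add_mset (b, c) G')"
  have ends_pair: "ends (i, j) = {i, j}" for i j by (simp add: ends_def)
  have "is_graph n H" "is_graph n K"
    using graph abcd by (auto simp: is_graph_def G' H_def K_def ends_pair)
  moreover have "valence H i = valence G i" "valence K i = valence G i" for i
    using abcd by (auto simp: G' H_def K_def valence_add_mset gh ends_pair)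
  ultimately have "H \<in> graphs_of_degree n w" "K \<in> graphs_of_degree n w"
    using deg by (auto simp: graphs_of_degree_def)
  moreover have "potential n H < potential n G" "potential n K < potential n G"
    using abcd potential_resolve[OF abcd]
    by (simp_all add: G' H_def K_def potential_add_mset edge_potential_ends[OF gh(3)]
        edge_potential_ends[OF gh(4)] edge_potential_ends[OF ends_pair])
  moreover have "Xvar G = Xvar H + Xvar K \<or> Xvar G = - (Xvar H + Xvar K)"
  proof -
    \<comment> \<open>The edges \<open>g\<close> and \<open>h\<close> may be directed either way;
      reorienting them costs the overall sign left open in the conclusion.\<close>
    have "underlying G = underlying (add_mset (a, c) (add_mset (b, d) G'))"
      by (simp add: G' underlying_def gh ends_pair)
    moreover have "Xvar (add_mset (a, c) (add_mset (b, d) G')) = Xvar H + Xvar K"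
      by (simp add: H_def K_def Xvar_add_mset algebra_simps)
    ultimately show ?thesis using Xvar_underlying by metis
  qed
  ultimately show ?thesis by (rule that)
qed

text \<open>Strong induction on \<open>potential\<close>: a crossing splits the variable into two of
  smaller potential, while a non-crossing graph shares its underlying graph with a member of
  \<open>R\<close> and so agrees with it up to sign.\<close>

lemma Xvar_in_span:
  assumes R: "orientation_choice (noncrossing_graphs_of_degree n w) R"
    and "G \<in> graphs_of_degree n w"
  shows "Xvar G \<in> zmod.span (Xvar ` R)"
  using assms(2)
proof (induction "potential n G" arbitrary: G rule: less_induct)
  case less
  show ?case
  proof (cases "noncrossing n G")
    case True
    then have "underlying G \<in> underlying ` R"
      using R less.prems
      by (auto simp: orientation_choice_def bij_betw_def noncrossing_graphs_of_degree_def)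
    then obtain H where "H \<in> R" "underlying G = underlying H" by blast
    then show ?thesis
      using Xvar_underlying[of G H] by (metis imageI zmod.span_base zmod.span_neg)
  next
    case False
    then obtain H K where "H \<in> graphs_of_degree n w" "K \<in> graphs_of_degree n w"
        "potential n H < potential n G" "potential n K < potential n G"
        and X: "Xvar G = Xvar H + Xvar K \<or> Xvar G = - (Xvar H + Xvar K)"
      using less.prems Xvar_resolve_crossing by metis
    then have "Xvar H + Xvar K \<in> zmod.span (Xvar ` R)"
      using less.hyps by (intro zmod.span_add) auto
    then show ?thesis using X zmod.span_neg by metis
  qed
qed

section \<open>Generated subgroups and the basis property\<close>

text \<open>Scaling by an integer is repeated addition, possibly followed by negation, so subgroups
  are the same as submodules over the integers. This links the span in \<open>is_int_basis\<close>
  to the generated group.\<close>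

lemma span_eq_group_closure: "zmod.span S = group_closure S"
proof
  have "zmod.subspace (group_closure S)"
  proof (rule zmod.subspaceI)
    fix c p
    assume p: "p \<in> group_closure S"
    show "zscale c p \<in> group_closure S"
    proof (cases c)
      case (nonneg k)
      then show ?thesis using p by (simp add: zscale_def group_closure_scalar_mult_left)
    next
      case (neg k)
      then have "zscale c p = - (of_nat (Suc k) * p)"
        by (simp add: zscale_def del: of_nat_Suc)
      then show ?thesis
        using p by (simp only: group_closure_minus_iff group_closure_scalar_mult_left)
    qed
  qed (auto intro: group_closure_add)
  then show "zmod.span S \<subseteq> group_closure S"
    by (intro zmod.span_minimal) (auto intro: group_closure.base)
  show "group_closure S \<subseteq> zmod.span S"
  proof
    fix p
    assume "p \<in> group_closure S"
    then show "p \<in> zmod.span S"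
      by induction (auto intro: zmod.span_base zmod.span_zero zmod.span_diff)
  qed
qed

theorem theorem2p5:
  fixes n :: nat and w :: "nat \<Rightarrow> nat" and R :: "digraph set"
  assumes "\<forall>i\<in>{1..n}. w i > 0"
    and "orientation_choice (noncrossing_graphs_of_degree n w) R"
  shows "is_int_basis Xvar R (group_closure (Xvar ` graphs_of_degree n w))"
proof -
  have R: "R \<subseteq> graphs_of_degree n w" "\<And>G. G \<in> R \<Longrightarrow> is_graph n G \<and> noncrossing n G"
    "inj_on underlying R"
    using assms(2)
    by (auto simp: orientation_choice_def noncrossing_graphs_of_degree_def graphs_of_degree_def bij_betw_def)
  have lead: "has_leading_monomial n (Xvar G) (graph_monomial G)" if "G \<in> R" for G
    using R(2)[OF that] Xvar_has_leading_monomial by blast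
  have inj_monomial: "inj_on graph_monomial R"
    using R graph_monomial_inj unfolding inj_on_def by blast
  have inj: "inj_on Xvar R"
  proof (rule inj_onI)
    fix G H
    assume "G \<in> R" "H \<in> R" "Xvar G = Xvar H"
    then show "G = H"
      using has_leading_monomial_unique lead inj_monomial by (metis inj_onD)
  qed
  have "zmod.independent (Xvar ` R)"
  proof (rule independent_leading_monomials)
    \<comment> \<open>Injectivity of \<open>Xvar\<close> on \<open>R\<close> lets the leading
      monomial be indexed by the polynomial instead of the graph.\<close>
    show "has_leading_monomial n p (graph_monomial (the_inv_into R Xvar p))" if "p \<in> Xvar ` R" for p
      using that lead inj by (auto simp: the_inv_into_f_f)
    show "inj_on (\<lambda>p. graph_monomial (the_inv_into R Xvar p)) (Xvar ` R)"
      using inj inj_monomial by (auto simp: inj_on_def the_inv_into_f_f)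
  qed
  moreover have "zmod.span (Xvar ` R) = group_closure (Xvar ` graphs_of_degree n w)"
  proof
    show "zmod.span (Xvar ` R) \<subseteq> group_closure (Xvar ` graphs_of_degree n w)"
      unfolding span_eq_group_closure[symmetric] using R(1) by (intro zmod.span_mono image_mono)
    show "group_closure (Xvar ` graphs_of_degree n w) \<subseteq> zmod.span (Xvar ` R)"
      unfolding span_eq_group_closure[symmetric]
      using Xvar_in_span[OF assms(2)] by (intro zmod.span_minimal) auto
  qed
  ultimately show ?thesis using inj by (simp add: is_int_basis_def)
qed

end
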